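(* Let $G$ be an Euler graph with only two types of cycles, i.e. $G\in\varepsilon_{ij}$ for some $i\neq j$ in $\{0,1,2,3\}$. Then $G$ is regular if and only if $G$ is a regular bipartite Euler graph of degree greater than $2$.
   Context: All graphs are finite, simple and connected. An Euler graph is a connected graph all of whose nodes have even degree. A cycle of length $n$ is said to be of type $i$ if $n\equiv i \pmod 4$, $i\in\{0,1,2,3\}$. For distinct $i,j\in\{0,1,2,3\}$, $\varepsilon_{ij}$ denotes the class of Euler graphs having only two types of cycles, $i$ and $j$: every cycle of $G$ has length $\equiv i$ or $\equiv j \pmod 4$, and $G$ has at least one cycle of type $i$ and at least one cycle of type $j$. *)

theory Defs
  imports "Graph_Theory.Graph_Theory"
begin

text \<open>
  A finite simple graph is a \<^const>\<open>pair_graph\<close>: a finite loop-free symmetric digraph in which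
  the undirected edge between \<open>u\<close> and \<open>v\<close> is the pair of arcs \<open>(u, v)\<close>, \<open>(v, u)\<close>. The degree of
  a node is therefore its \<^const>\<open>out_degree\<close>. The library's \<^const>\<open>connected\<close> requires at least
  one node.
\<close>

definition euler_graph :: "'a pair_pre_digraph \<Rightarrow> bool" where
  "euler_graph G \<longleftrightarrow> pair_graph G \<and> connected (with_proj G) \<and>
     (\<forall>v \<in> pverts G. even (out_degree (with_proj G) v))"

text \<open>
  The directed cycles of length 2, which run along one undirected edge and back, are not cycles
  of the undirected graph; in a loop-free graph the condition \<open>3 \<le> length p\<close> excludes exactly these.
\<close>

definition graph_cycle :: "'a pair_pre_digraph \<Rightarrow> ('a \<times> 'a) awalk \<Rightarrow> bool" where
  "graph_cycle G p \<longleftrightarrow> pre_digraph.cycle (with_proj G) p \<and> 3 \<le> length p"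

definition cycle_of_type :: "'a pair_pre_digraph \<Rightarrow> nat \<Rightarrow> ('a \<times> 'a) awalk \<Rightarrow> bool" where
  "cycle_of_type G i p \<longleftrightarrow> graph_cycle G p \<and> length p mod 4 = i mod 4"

definition two_type_euler :: "nat \<Rightarrow> nat \<Rightarrow> 'a pair_pre_digraph set" (\<open>\<epsilon>\<close>) where
  "\<epsilon> i j = {G. euler_graph G \<and>
     (\<forall>p. graph_cycle G p \<longrightarrow> cycle_of_type G i p \<or> cycle_of_type G j p) \<and>
     (\<exists>p. cycle_of_type G i p) \<and> (\<exists>p. cycle_of_type G j p)}"

definition regular_of_degree :: "'a pair_pre_digraph \<Rightarrow> nat \<Rightarrow> bool" where
  "regular_of_degree G d \<longleftrightarrow> (\<forall>v \<in> pverts G. out_degree (with_proj G) v = d)"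

definition regular :: "'a pair_pre_digraph \<Rightarrow> bool" where
  "regular G \<longleftrightarrow> (\<exists>d. regular_of_degree G d)"

definition bipartite :: "'a pair_pre_digraph \<Rightarrow> bool" where
  "bipartite G \<longleftrightarrow> (\<exists>U W. pverts G = U \<union> W \<and> U \<inter> W = {} \<and>
     parcs G \<subseteq> U \<times> W \<union> W \<times> U)"

end

theory Submission
  imports Defs
begin

text \<open>
  A connected 2-regular graph is a single cycle and so has only one type, hence a regular \<open>G\<close> has
  degree at least 4. Take a longest path \<open>x\<^sub>0, x\<^sub>1, \<dots>\<close> for which the smallest \<open>p \<ge> 2\<close> with
  \<open>x\<^sub>0 \<sim> x\<^sub>p\<close> is as small as possible. All neighbours of \<open>x\<^sub>0\<close> lie on the path, so there are
  \<open>p < q < r\<close> with \<open>x\<^sub>0 \<sim> x\<^sub>p, x\<^sub>q, x\<^sub>r\<close>, and the lengths of the cycles formed by these three chords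
  rule out the type sets \<open>{0, 1}\<close>, \<open>{0, 3}\<close> and \<open>{1, 3}\<close>. Since \<open>x\<^sub>p\<^sub>-\<^sub>1, \<dots>, x\<^sub>0, x\<^sub>p, \<dots>\<close> is also a longest
  path, the choice of \<open>p\<close> gives \<open>x\<^sub>p\<^sub>-\<^sub>1 \<sim> x\<^sub>s\<close> for some \<open>s > p\<close>. This yields a subdivision of \<open>K\<^sub>4\<close>,
  which rules out \<open>{1, 2}\<close> and \<open>{2, 3}\<close>. In the remaining case \<open>{0, 2}\<close> there is no odd cycle.
\<close>

section \<open>Residues modulo 4\<close>

lemma mod_summands:
  fixes a b c k m :: nat
  shows "(a mod m + k) mod m = (a + k) mod m"
    and "(a mod m + b mod m + k) mod m = (a + b + k) mod m"
    and "(a mod m + b mod m + c mod m + k) mod m = (a + b + c + k) mod m"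
  by (auto intro!: mod_add_cong)

text \<open>Modulo 4, the lengths x + 2, y + 4 and x + y + 2 force x = 3, y = 1 for {1, 2} and x =
  1, y = 3 for {2, 3}. Then p + 1 and y + p + 1 force p = 0 or p = 2, respectively, and p + x + 1 is
  divisible by 4. The formal proof checks all 64 residue triples.\<close>

lemma K4_two_types:
  fixes p x y :: nat
  assumes "T \<in> {{1, 2}, {2, 3}}"
  shows "\<not> (\<forall>n \<in> {p + 1, x + 2, x + y + 2, y + p + 1, p + x + 1, p + x + y + 1, y + 4}. n mod 4 \<in> T)"
proof -
  have residues: "\<forall>a \<in> {0, 1, 2, 3::nat}. \<forall>b \<in> {0, 1, 2, 3::nat}. \<forall>c \<in> {0, 1, 2, 3::nat}.
      \<not> (\<forall>n \<in> {a + 1, b + 2, b + c + 2, c + a + 1, a + b + 1, a + b + c + 1, c + 4}. n mod 4 \<in> T)"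
    using assms by (elim insertE emptyE) simp_all
  have mod: "k mod 4 \<in> {0, 1, 2, 3}" for k :: nat by auto
  have "\<not> (\<forall>n \<in> {p mod 4 + 1, x mod 4 + 2, x mod 4 + y mod 4 + 2, y mod 4 + p mod 4 + 1,
      p mod 4 + x mod 4 + 1, p mod 4 + x mod 4 + y mod 4 + 1, y mod 4 + 4}. n mod 4 \<in> T)"
    by (rule residues[THEN bspec, THEN bspec, THEN bspec, OF mod mod mod])
  then show ?thesis by (simp only: ball_simps mod_summands not_False_eq_True)
qed

text \<open>For {0, 1} and {0, 3}, the last three lengths force u = v = 3 or u = v = 1 modulo 4,
  respectively; so p, p + u and p + u + v have three different residues where two are allowed. For
  {1, 3}, p and p + u are even, hence so is u + 2.\<close>

lemma fan_two_types:
  fixes p u v :: nat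
  assumes "T \<in> {{0, 1}, {0, 3}, {1, 3}}"
  shows "\<not> (\<forall>n \<in> {p + 1, p + u + 1, p + u + v + 1, u + 2, v + 2, u + v + 2}. n mod 4 \<in> T)"
proof -
  have residues: "\<forall>a \<in> {0, 1, 2, 3::nat}. \<forall>b \<in> {0, 1, 2, 3::nat}. \<forall>c \<in> {0, 1, 2, 3::nat}.
      \<not> (\<forall>n \<in> {a + 1, a + b + 1, a + b + c + 1, b + 2, c + 2, b + c + 2}. n mod 4 \<in> T)"
    using assms by (elim insertE emptyE) simp_all
  have mod: "k mod 4 \<in> {0, 1, 2, 3}" for k :: nat by auto
  have "\<not> (\<forall>n \<in> {p mod 4 + 1, p mod 4 + u mod 4 + 1, p mod 4 + u mod 4 + v mod 4 + 1,
      u mod 4 + 2, v mod 4 + 2, u mod 4 + v mod 4 + 2}. n mod 4 \<in> T)"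
    by (rule residues[THEN bspec, THEN bspec, THEN bspec, OF mod mod mod])
  then show ?thesis by (simp only: ball_simps mod_summands not_False_eq_True)
qed

section \<open>Cycles and paths as vertex lists\<close>

locale finite_simple_graph =
  fixes V :: "'a set" and E :: "'a \<Rightarrow> 'a \<Rightarrow> bool"
  assumes finite_V: "finite V"
    and E_V: "E x y \<Longrightarrow> x \<in> V"
    and E_sym: "E x y \<Longrightarrow> E y x"
    and E_irrefl: "\<not> E x x"
begin

text \<open>The first vertex is not repeated at the end, so the list is as long as the
  cycle.\<close>

definition vertex_cycle :: "'a list \<Rightarrow> bool" where
  "vertex_cycle xs \<longleftrightarrow> 3 \<le> length xs \<and> distinct xs \<and> successively E xs \<and> E (last xs) (hd xs)"

definition cycle_length :: "nat \<Rightarrow> bool" where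
  "cycle_length n \<longleftrightarrow> (\<exists>xs. vertex_cycle xs \<and> length xs = n)"

text \<open>Membership in \<open>V\<close> is explicit because \<open>successively\<close> says
  nothing about a one-vertex list.\<close>

definition vertex_path :: "'a list \<Rightarrow> bool" where
  "vertex_path xs \<longleftrightarrow> set xs \<subseteq> V \<and> distinct xs \<and> successively E xs"

lemma finite_neighbours: "finite {y. E x y}"
  by (rule finite_subset[OF _ finite_V]) (auto dest: E_sym E_V)

lemma successively_E_sym: "successively (\<lambda>x y. E y x) xs \<longleftrightarrow> successively E xs"
  by (intro iffI; erule successively_mono) (auto dest: E_sym)

subsection \<open>Cycles along a path\<close>

lemma path_step:
  assumes "vertex_path xs" "Suc k < length xs"
  shows "E (xs ! k) (xs ! Suc k)"
proof -
  have "successively E (take k xs @ xs ! k # xs ! Suc k # drop (Suc (Suc k)) xs)"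
    using assms by (simp add: vertex_path_def Cons_nth_drop_Suc)
  then show ?thesis by (simp add: successively_append_iff)
qed

lemma successively_upt:
  assumes "\<And>k. a \<le> k \<Longrightarrow> Suc k < b \<Longrightarrow> R k (Suc k)"
  shows "successively R [a..<b]"
  using assms
proof (induction b)
  case (Suc b)
  then show ?case by (cases b) (auto simp: successively_append_iff)
qed simp

text \<open>Indexing a distinct list is injective, so a cycle on path vertices can be given by its
  positions, leaving only index arithmetic.\<close>

lemma cycle_length_path_indices:
  assumes "vertex_path xs" "distinct ks" "set ks \<subseteq> {..<length xs}"
    and "successively (\<lambda>a b. E (xs ! a) (xs ! b)) ks"
    and "E (xs ! last ks) (xs ! hd ks)" "3 \<le> length ks"
  shows "cycle_length (length ks)"
proof -
  have "inj_on ((!) xs) (set ks)"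
    using assms(1,3) by (intro inj_on_nth) (auto simp: vertex_path_def)
  moreover have "ks \<noteq> []" using assms(6) by auto
  ultimately have "vertex_cycle (map ((!) xs) ks)"
    using assms
    by (simp add: vertex_cycle_def distinct_map successively_map last_map hd_map)
  then show ?thesis by (auto simp: cycle_length_def)
qed

lemma cycle_length_chord:
  assumes "vertex_path xs" "2 \<le> p" "p < length xs" "E (xs ! 0) (xs ! p)"
  shows "cycle_length (p + 1)"
proof -
  have "cycle_length (length [0..<Suc p])"
    using assms
    by (intro cycle_length_path_indices[of xs] successively_upt path_step) (auto intro: E_sym)
  then show ?thesis by simp
qed

lemma cycle_length_two_chords:
  assumes "vertex_path xs" "0 < p" "p < q" "q < length xs" "E (xs ! 0) (xs ! p)" "E (xs ! 0) (xs ! q)"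
  shows "cycle_length (q - p + 2)"
proof -
  have "cycle_length (length (0 # [p..<Suc q]))"
    using assms
    by (intro cycle_length_path_indices[of xs])
       (auto simp: successively_Cons hd_append simp del: upt_Suc
             intro!: successively_upt path_step intro: E_sym)
  then show ?thesis using assms by (simp add: Suc_diff_le)
qed

text \<open>Posa's rotation for a chord between positions \<open>0\<close> and \<open>p\<close>: the
  new path starts at the old position \<open>p - 1\<close>, and positions from \<open>p\<close> on
  are unchanged.\<close>

definition rotate_path :: "nat \<Rightarrow> 'a list \<Rightarrow> 'a list" where
  "rotate_path p xs = rev (take p xs) @ drop p xs"

lemma length_rotate_path [simp]: "length (rotate_path p xs) = length xs"
  by (simp add: rotate_path_def)

lemma nth_rotate_path:
  assumes "p < length xs" "k < length xs"
  shows "rotate_path p xs ! k = (if k < p then xs ! (p - Suc k) else xs ! k)"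
  using assms by (auto simp: rotate_path_def nth_append rev_nth)

lemma nth_rotate_path_0:
  assumes "0 < p" "p < length xs"
  shows "rotate_path p xs ! 0 = xs ! (p - 1)"
proof -
  have "0 < length xs" using assms by linarith
  with assms show ?thesis by (simp only: nth_rotate_path if_True One_nat_def)
qed

lemma vertex_path_rotate:
  assumes "vertex_path xs" "0 < p" "p < length xs" "E (xs ! 0) (xs ! p)"
  shows "vertex_path (rotate_path p xs)"
proof -
  obtain as bs where xs: "xs = as @ bs" "p = length as"
    by (rule that[of "take p xs" "drop p xs"]) (use assms(3) in auto)
  then have "as \<noteq> []" "bs \<noteq> []" using assms by auto
  then show ?thesis
    using assms unfolding vertex_path_def rotate_path_def xs
    by (auto simp: successively_append_iff successively_E_sym last_rev hd_conv_nth nth_append)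
qed

text \<open>
  The vertices at positions \<open>0\<close>, \<open>p - 1\<close>, \<open>p\<close> and \<open>s\<close> are the branch vertices of a subdivision of
  \<open>K\<^sub>4\<close>; together with \<open>p + 1\<close>, \<open>q + 1\<close> and \<open>q - p + 2\<close> these are the lengths of its seven cycles.
\<close>
lemma cycle_length_K4:
  assumes "vertex_path xs" "2 \<le> p" "p < s" "s \<le> q" "q < length xs"
    and "E (xs ! 0) (xs ! p)" "E (xs ! 0) (xs ! q)" "E (xs ! (p - 1)) (xs ! s)"
  shows "cycle_length (s - p + 2)" "cycle_length (q - s + p + 1)"
    "cycle_length (s + 1)" "cycle_length (q - s + 4)"
proof -
  note [simp] = successively_Cons successively_append_iff successively_E_sym
  have step: "E (xs ! (p - 1)) (xs ! p)"
    using path_step[of xs "p - 1"] assms by simp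
  have up: "successively (\<lambda>a b. E (xs ! a) (xs ! b)) [a..<b]" if "b \<le> length xs" for a b
    using that assms(1) by (intro successively_upt path_step) auto
  have down: "successively (\<lambda>a b. E (xs ! b) (xs ! a)) [a..<b]" if "b \<le> length xs" for a b
    using that assms(1) by (intro successively_upt E_sym[OF path_step]) auto
  have last0: "last [0..<p] = p - 1" "hd [0..<p] = 0" "[0..<p] \<noteq> []"
    using assms by (auto simp: last_conv_nth)
  have hd: "hd [a..<Suc b] = a" "last [a..<Suc b] = b" "[a..<Suc b] \<noteq> []" if "a \<le> b" for a b
    using that by (simp_all add: hd_append)
  have "cycle_length (length ((p - 1) # [p..<Suc s]))"
    using assms step up
    by (intro cycle_length_path_indices[of xs])
       (auto simp: hd simp del: upt_Suc intro: E_sym)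
  then show "cycle_length (s - p + 2)" using assms by (simp add: Suc_diff_le)
  have "cycle_length (length ([0..<p] @ [s..<Suc q]))"
    using assms up
    by (intro cycle_length_path_indices[of xs])
       (auto simp: hd last0 simp del: upt_Suc intro: E_sym)
  then show "cycle_length (q - s + p + 1)" using assms by (simp add: Suc_diff_le add.commute)
  \<comment> \<open>From \<open>p - 1\<close> down to \<open>0\<close>, along the chord to
    \<open>p\<close>, up to \<open>s\<close>, and back by the chord to \<open>p - 1\<close>.\<close>
  have "cycle_length (length (rev [0..<p] @ [p..<Suc s]))"
    using assms up down
    by (intro cycle_length_path_indices[of xs])
       (auto simp: hd last0 hd_rev last_rev simp del: upt_Suc intro: E_sym)
  then show "cycle_length (s + 1)" using assms by (simp add: Suc_diff_le)
  have "cycle_length (length (0 # p # (p - 1) # [s..<Suc q]))"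
    using assms step up
    by (intro cycle_length_path_indices[of xs])
       (auto simp: hd simp del: upt_Suc intro: E_sym)
  then show "cycle_length (q - s + 4)" using assms by (simp add: Suc_diff_le numeral_eq_Suc)
qed

text \<open>If s > q, rotation exchanges the vertices at positions \<open>0\<close> and
  \<open>p - 1\<close>, and with them the roles of \<open>q\<close> and \<open>s\<close>. So the
  case s <= q suffices, with \<open>x\<close> and \<open>y\<close> the gaps from \<open>p\<close> to
  the nearer and from there to the farther of \<open>q\<close> and \<open>s\<close>.\<close>

lemma cycle_lengths_K4_cases:
  assumes "vertex_path xs" "2 \<le> p" "p < q" "p < s" "q < length xs" "s < length xs"
    and "E (xs ! 0) (xs ! p)" "E (xs ! 0) (xs ! q)" "E (xs ! (p - 1)) (xs ! s)"
  shows "\<exists>x y. \<forall>n \<in> {p + 1, x + 2, x + y + 2, y + p + 1, p + x + 1, p + x + y + 1, y + 4}.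
    cycle_length n"
proof -
  have main: ?thesis
    if "vertex_path ys" "p < a" "a \<le> b" "b < length ys"
      and "E (ys ! 0) (ys ! p)" "E (ys ! 0) (ys ! b)" "E (ys ! (p - 1)) (ys ! a)" for ys a b
    using cycle_length_K4[of ys p a b] cycle_length_chord[of ys p] cycle_length_chord[of ys b]
      cycle_length_two_chords[of ys p b] that assms(2)
    by (intro exI[of _ "a - p"] exI[of _ "b - a"]) (simp add: add.commute)
  show ?thesis
  proof (cases "s \<le> q")
    case True
    then show ?thesis using main[of xs s q] assms by simp
  next
    case False
    \<comment> \<open>This path edge is the chord from \<open>0\<close> to \<open>p\<close> in the
      rotated path.\<close>
    have "E (xs ! (p - 1)) (xs ! p)" using path_step[of xs "p - 1"] assms by simp
    then show ?thesis
      using main[of "rotate_path p xs" q s] vertex_path_rotate[of xs p] assms False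
      by (simp add: nth_rotate_path nth_rotate_path_0)
  qed
qed

subsection \<open>Longest paths\<close>

definition longest_path :: "'a list \<Rightarrow> bool" where
  "longest_path xs \<longleftrightarrow> vertex_path xs \<and> (\<forall>ys. vertex_path ys \<longrightarrow> length ys \<le> length xs)"

lemma longest_path_exists: "\<exists>xs. longest_path xs"
proof -
  have "vertex_path []" by (simp add: vertex_path_def)
  moreover have "length xs < Suc (card V)" if "vertex_path xs" for xs
    using that finite_V distinct_card[of xs] card_mono[of V "set xs"]
    by (simp add: vertex_path_def)
  ultimately show ?thesis
    using ex_has_greatest_nat[of vertex_path "[]" length "Suc (card V)"]
    by (auto simp: longest_path_def intro: less_imp_le)
qed

lemma longest_path_nonempty:
  assumes "longest_path xs" "V \<noteq> {}"
  shows "xs \<noteq> []"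
proof
  assume "xs = []"
  obtain x where "x \<in> V" using assms(2) by blast
  then have "vertex_path [x]" by (simp add: vertex_path_def)
  then show False using assms(1) \<open>xs = []\<close> by (force simp: longest_path_def)
qed

text \<open>A neighbour of the first vertex off the path could be prepended.\<close>

lemma longest_path_neighbours:
  assumes "longest_path xs" "xs \<noteq> []" "E (xs ! 0) y"
  shows "y \<in> set xs"
proof (rule ccontr)
  assume "y \<notin> set xs"
  moreover have "E y (hd xs)" using assms by (simp add: hd_conv_nth E_sym)
  ultimately have "vertex_path (y # xs)"
    using assms E_V by (auto simp: longest_path_def vertex_path_def successively_Cons)
  then show False using assms(1) by (force simp: longest_path_def)
qed

lemma longest_path_card_neighbours:
  assumes "longest_path xs" "xs \<noteq> []"
  shows "card {k. k < length xs \<and> E (xs ! 0) (xs ! k)} = card {y. E (xs ! 0) y}"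
proof (rule bij_betw_same_card)
  have "distinct xs" using assms by (simp add: longest_path_def vertex_path_def)
  then show "bij_betw ((!) xs) {k. k < length xs \<and> E (xs ! 0) (xs ! k)} {y. E (xs ! 0) y}"
    using longest_path_neighbours[OF assms]
    by (auto simp: bij_betw_def inj_on_def nth_eq_iff_index_eq in_set_conv_nth image_iff)
qed

text \<open>Used for the positions of the neighbours of a first vertex: by minimality of
  \<open>p\<close>, only position \<open>1\<close> can precede \<open>p\<close>, so removing
  \<open>1\<close> and \<open>p\<close> from four positions leaves two beyond
  \<open>p\<close>.\<close>

lemma ex_two_greater:
  fixes I :: "nat set"
  assumes "finite I" "4 \<le> card I" "0 \<notin> I" "p \<in> I" "\<And>k. k \<in> I \<Longrightarrow> 2 \<le> k \<Longrightarrow> p \<le> k"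
  obtains q r where "q \<in> I" "r \<in> I" "p < q" "q < r"
proof -
  have "card I - card {1, p} \<le> card (I - {1, p})" by (rule diff_card_le_card_Diff) simp
  moreover have "card {1, p} \<le> 2" by (simp add: card_insert_if)
  ultimately have "\<not> card (I - {1, p}) \<le> Suc 0" using assms(2) by simp
  then obtain a b where ab: "a \<in> I - {1, p}" "b \<in> I - {1, p}" "a \<noteq> b"
    using assms(1) by (auto simp: card_le_Suc0_iff_eq)
  have "p < k" if "k \<in> I - {1, p}" for k
    using that assms(3) assms(5)[of k] by (cases "k = 0") auto
  then show ?thesis using ab that[of a b] that[of b a] by (metis DiffD1 linorder_neqE_nat)
qed

lemma longest_path_configuration:
  assumes "V \<noteq> {}" and deg: "\<And>x. x \<in> V \<Longrightarrow> 4 \<le> card {y. E x y}"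
  obtains xs p q r s where "vertex_path xs" "2 \<le> p" "p < q" "q < r" "r < length xs"
    "E (xs ! 0) (xs ! p)" "E (xs ! 0) (xs ! q)" "E (xs ! 0) (xs ! r)"
    "p < s" "s < length xs" "E (xs ! (p - 1)) (xs ! s)"
proof -
  define I where "I xs = {k. k < length xs \<and> E (xs ! 0) (xs ! k)}" for xs
  have I: "finite (I xs)" "4 \<le> card (I xs)" "0 \<notin> I xs" if "longest_path xs" for xs
  proof -
    have "xs \<noteq> []" using longest_path_nonempty that assms(1) by blast
    moreover from this have "xs ! 0 \<in> V"
      using that by (auto simp: longest_path_def vertex_path_def)
    ultimately show "finite (I xs)" "4 \<le> card (I xs)" "0 \<notin> I xs"
      using longest_path_card_neighbours[OF that] deg
      by (auto simp: I_def E_irrefl)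
  qed
  \<comment> \<open>The minimum ranges over all longest paths at once, so it also bounds the rotated
    path.\<close>
  define good where "good p \<longleftrightarrow> 2 \<le> p \<and> (\<exists>xs. longest_path xs \<and> p \<in> I xs)" for p
  define p where "p = (LEAST p. good p)"
  obtain zs where zs: "longest_path zs" using longest_path_exists by blast
  have "\<not> I zs \<subseteq> {1}" using I[OF zs] card_mono[of "{1::nat}" "I zs"] by auto
  then obtain k where "k \<in> I zs" "k \<noteq> 1" by blast
  with I[OF zs] have "good k" using zs by (cases k) (auto simp: good_def)
  then have "good p" unfolding p_def by (rule LeastI)
  then obtain xs where xs: "longest_path xs" "p \<in> I xs" and p: "2 \<le> p" by (auto simp: good_def)
  have min: "p \<le> k" if "longest_path ys" "k \<in> I ys" "2 \<le> k" for ys k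
    unfolding p_def by (rule Least_le) (use that in \<open>auto simp: good_def\<close>)
  define ys where "ys = rotate_path p xs"
  have plen: "p < length xs" using xs by (simp add: I_def)
  have ys: "longest_path ys"
    using xs p vertex_path_rotate[of xs p] by (auto simp: I_def ys_def longest_path_def)
  have len: "length ys = length xs" by (simp add: ys_def)
  have nth: "ys ! 0 = xs ! (p - 1)" "\<And>k. p \<le> k \<Longrightarrow> k < length xs \<Longrightarrow> ys ! k = xs ! k"
    using plen p by (simp_all add: ys_def nth_rotate_path nth_rotate_path_0)
  have "E (xs ! (p - 1)) (xs ! p)"
    using path_step[of xs "p - 1"] xs p plen by (simp add: longest_path_def)
  \<comment> \<open>The old path edge now joins the new first vertex to position \<open>p\<close>;
    hence \<open>p\<close> is minimal for \<open>ys\<close> too, and a neighbour beyond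
    \<open>p\<close> exists.\<close>
  then have pys: "p \<in> I ys" using nth plen len by (simp add: I_def)
  obtain q r where "q \<in> I xs" "r \<in> I xs" "p < q" "q < r"
    by (rule ex_two_greater[OF I[OF xs(1)] xs(2) min[OF xs(1)]])
  moreover obtain s where "s \<in> I ys" "p < s"
    by (rule ex_two_greater[OF I[OF ys] pys min[OF ys]])
  ultimately show ?thesis
    using that[of xs p q r s] xs p nth len by (auto simp: I_def longest_path_def)
qed

lemma cycle_types_min_degree_4:
  assumes "V \<noteq> {}" and deg: "\<And>x. x \<in> V \<Longrightarrow> 4 \<le> card {y. E x y}"
    and types: "\<And>n. cycle_length n \<Longrightarrow> n mod 4 = i \<or> n mod 4 = j"
    and "i \<in> {0, 1, 2, 3}" "j \<in> {0, 1, 2, 3}"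
  shows "{i, j} = {0, 2}"
proof -
  obtain xs p q r s where c: "vertex_path xs" "2 \<le> p" "p < q" "q < r" "r < length xs"
    "E (xs ! 0) (xs ! p)" "E (xs ! 0) (xs ! q)" "E (xs ! 0) (xs ! r)"
    "p < s" "s < length xs" "E (xs ! (p - 1)) (xs ! s)"
    using longest_path_configuration[OF assms(1) deg] .
  obtain u v where uv: "q = p + u" "r = p + u + v" 
    using c(3,4) by (metis less_imp_add_positive)
  have "\<forall>n \<in> {p + 1, p + u + 1, p + u + v + 1, u + 2, v + 2, u + v + 2}. cycle_length n"
    using c uv cycle_length_chord[of xs p] cycle_length_chord[of xs q] cycle_length_chord[of xs r]
      cycle_length_two_chords[of xs p q] cycle_length_two_chords[of xs q r]
      cycle_length_two_chords[of xs p r] by (simp add: add.assoc)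
  then have fan: "\<forall>n \<in> {p + 1, p + u + 1, p + u + v + 1, u + 2, v + 2, u + v + 2}.
      n mod 4 = i \<or> n mod 4 = j"
    using types by blast
  obtain x y where "\<forall>n \<in> {p + 1, x + 2, x + y + 2, y + p + 1, p + x + 1, p + x + y + 1, y + 4}.
      cycle_length n"
    using cycle_lengths_K4_cases[OF c(1,2,3,9) _ c(10,6,7,11)] c(4,5) by (meson less_trans)
  then have K4: "\<forall>n \<in> {p + 1, x + 2, x + y + 2, y + p + 1, p + x + 1, p + x + y + 1, y + 4}.
      n mod 4 = i \<or> n mod 4 = j"
    using types by blast
  show ?thesis
  proof (rule ccontr)
    assume "{i, j} \<noteq> {0, 2}"
    \<comment> \<open>Inclusion instead of equality also covers i = j.\<close>
    then have "(\<exists>T \<in> {{1, 2}, {2, 3}}. {i, j} \<subseteq> T) \<or> (\<exists>T \<in> {{0, 1}, {0, 3}, {1, 3}}. {i, j} \<subseteq> T)"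
      using assms(4,5) by auto
    then show False
    proof (elim disjE bexE)
      fix T :: "nat set"
      assume T: "T \<in> {{1, 2}, {2, 3}}" "{i, j} \<subseteq> T"
      show False using K4_two_types[OF T(1), of p x y] K4 T(2) by blast
    next
      fix T :: "nat set"
      assume T: "T \<in> {{0, 1}, {0, 3}, {1, 3}}" "{i, j} \<subseteq> T"
      show False using fan_two_types[OF T(1), of p u v] fan T(2) by blast
    qed
  qed
qed

subsection \<open>Bipartition\<close>

text \<open>A repeated vertex cuts the closed walk into two shorter closed walks whose lengths add
  up, so one of them is odd.\<close>

lemma odd_closed_walk_imp_odd_cycle:
  assumes "odd (length xs)" "successively E xs" "E (last xs) (hd xs)"
  shows "\<exists>n. odd n \<and> cycle_length n"
  using assms
proof (induction xs rule: length_induct)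
  case (1 xs)
  show ?case
  proof (cases "distinct xs")
    case True
    \<comment> \<open>A closed walk of length 1 would be a loop.\<close>
    have "length xs \<noteq> 1" using "1.prems"(3) E_irrefl by (auto simp: length_Suc_conv)
    then have "3 \<le> length xs" using "1.prems"(1) by presburger
    then have "vertex_cycle xs" using True "1.prems" by (simp add: vertex_cycle_def)
    then show ?thesis using "1.prems"(1) by (auto simp: cycle_length_def)
  next
    case False
    then obtain as y bs cs where xs: "xs = as @ [y] @ bs @ [y] @ cs"
      using not_distinct_decomp by blast
    have a: "successively E (y # bs)" "E (last (y # bs)) (hd (y # bs))"
    proof -
      have "successively E (as @ (y # bs) @ (y # cs))" using "1.prems"(2) by (simp add: xs)
      then have "successively E ((y # bs) @ (y # cs))" by (simp only: successively_append_iff)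
      then show "successively E (y # bs)" "E (last (y # bs)) (hd (y # bs))"
        by (simp_all only: successively_append_iff list.sel list.distinct simp_thms)
    qed
    have b: "successively E (as @ y # cs)" "E (last (as @ y # cs)) (hd (as @ y # cs))"
      using "1.prems"(2,3)
      by (auto simp: xs successively_append_iff successively_Cons hd_append split: if_splits)
    have "odd (length (y # bs)) \<or> odd (length (as @ y # cs))"
      using "1.prems"(1) by (auto simp: xs)
    moreover have "length (y # bs) < length xs" "length (as @ y # cs) < length xs"
      by (simp_all add: xs)
    ultimately show ?thesis using "1.IH" a b by blast
  qed
qed

lemma two_colouring:
  assumes conn: "\<And>x. x \<in> V \<Longrightarrow> E\<^sup>*\<^sup>* r x" and even: "\<And>n. cycle_length n \<Longrightarrow> even n"
  obtains U W where "V = U \<union> W" "U \<inter> W = {}"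
    "\<And>x y. E x y \<Longrightarrow> x \<in> U \<and> y \<in> W \<or> x \<in> W \<and> y \<in> U"
proof -
  define walk where "walk xs x \<longleftrightarrow> xs \<noteq> [] \<and> hd xs = r \<and> last xs = x \<and> successively E xs" for xs x
  \<comment> \<open>Colour by the parity of walks from \<open>r\<close>; disjointness is the point
    that needs the absence of odd cycles.\<close>
  define U where "U = {x \<in> V. \<exists>xs. walk xs x \<and> odd (length xs)}"
  define W where "W = {x \<in> V. \<exists>xs. walk xs x \<and> even (length xs)}"
  have ex: "\<exists>xs. walk xs x" if "E\<^sup>*\<^sup>* r x" for x
    using that
  proof induction
    case base
    then show ?case by (intro exI[of _ "[r]"]) (simp add: walk_def)
  next
    case (step x y)
    then obtain xs where "walk xs x" by blast
    then show ?case using step.hyps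
      by (intro exI[of _ "xs @ [y]"]) (auto simp: walk_def successively_append_iff)
  qed
  have "x \<in> U \<union> W" if x: "x \<in> V" for x
  proof -
    obtain xs where "walk xs x" using ex[OF conn[OF x]] by blast
    then show ?thesis using x by (cases "even (length xs)") (auto simp: U_def W_def)
  qed
  then have 1: "V = U \<union> W" by (auto simp: U_def W_def)
  have 2: "U \<inter> W = {}"
  proof (rule ccontr)
    assume "U \<inter> W \<noteq> {}"
    then obtain x xs ys where xs: "walk xs x" "odd (length xs)"
      and ys: "walk ys x" "even (length ys)"
      by (auto simp: U_def W_def)
    \<comment> \<open>Going out along \<open>xs\<close> and back along \<open>ys\<close> must not
      repeat the shared ends \<open>r\<close> and \<open>x\<close>, so only the interior
      \<open>zs\<close> is reversed and appended. It has even length, so the closed walk is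
      odd.\<close>
    obtain zs where zs: "ys = r # zs @ [x]"
    proof -
      have "ys = r # tl ys" using ys(1) by (auto simp: walk_def)
      moreover from this have "tl ys \<noteq> []"
        using ys(2) by (metis One_nat_def length_Cons list.size(3) odd_one)
      ultimately have "ys = r # butlast (tl ys) @ [x]"
        using ys(1) by (metis append_butlast_last_id last_tl walk_def)
      then show thesis by (rule that)
    qed
    have "odd (length (xs @ rev zs))" using xs ys zs by auto
    moreover have "successively E (xs @ rev zs)" "E (last (xs @ rev zs)) (hd (xs @ rev zs))"
      using xs(1) ys(1)
      by (auto simp: walk_def zs successively_append_iff successively_Cons successively_E_sym
          hd_rev last_rev hd_append split: if_splits intro: E_sym)
    ultimately obtain n where "odd n" "cycle_length n" using odd_closed_walk_imp_odd_cycle by blast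
    then show False using even by blast
  qed
  have step: "\<exists>ys. walk ys y \<and> length ys = Suc (length xs)" if "walk xs x" "E x y" for xs x y
    using that by (intro exI[of _ "xs @ [y]"]) (auto simp: walk_def successively_append_iff)
  have 3: "x \<in> U \<and> y \<in> W \<or> x \<in> W \<and> y \<in> U" if xy: "E x y" for x y
  proof -
    have V: "x \<in> V" "y \<in> V" using E_V[OF xy] E_V[OF E_sym[OF xy]] by auto
    obtain xs where xs: "walk xs x" using ex[OF conn[OF V(1)]] by blast
    obtain ys where "walk ys y" "length ys = Suc (length xs)" using step[OF xs xy] by blast
    then have "if even (length xs) then x \<in> W \<and> y \<in> U else x \<in> U \<and> y \<in> W"
      using V xs unfolding U_def W_def by (metis (mono_tags, lifting) even_Suc mem_Collect_eq)
    then show ?thesis by (simp split: if_splits)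
  qed
  show ?thesis by (rule that[OF 1 2 3])
qed

subsection \<open>Degree two\<close>

lemma vertex_cycle_rotate: "vertex_cycle (as @ bs) \<Longrightarrow> vertex_cycle (bs @ as)"
  by (cases "as = []"; cases "bs = []") (auto simp: vertex_cycle_def successively_append_iff)

text \<open>Rotate the cycle to start at \<open>x\<close>; the rest has at least two vertices, and
  its two ends are the neighbours.\<close>

lemma vertex_cycle_two_neighbours:
  assumes "vertex_cycle xs" "x \<in> set xs"
  obtains y z where "y \<noteq> z" "E x y" "E x z" "y \<in> set xs" "z \<in> set xs"
proof -
  obtain as bs where xs: "xs = as @ x # bs" using assms(2) by (meson split_list)
  define ys where "ys = bs @ as"
  have "vertex_cycle (x # ys)"
    using vertex_cycle_rotate[of as "x # bs"] assms(1) by (simp add: xs ys_def)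
  then have ys: "2 \<le> length ys" "distinct ys" "E x (hd ys)" "E x (last ys)"
    by (auto simp: vertex_cycle_def successively_Cons split: if_splits intro: E_sym)
  then have "ys \<noteq> []" by auto
  then have "hd ys \<in> set ys" "last ys \<in> set ys" by auto
  moreover have "hd ys \<noteq> last ys"
    using ys \<open>ys \<noteq> []\<close> by (simp add: hd_conv_nth last_conv_nth nth_eq_iff_index_eq)
  moreover have "set ys \<subseteq> set xs" by (auto simp: xs ys_def)
  ultimately show ?thesis using that ys by blast
qed

text \<open>On a cycle, the two cycle neighbours of a vertex are all its neighbours. The cycle is
  thus closed under adjacency, and by connectedness it covers \<open>V\<close>.\<close>

lemma cycle_length_two_regular:
  assumes conn: "\<And>x y. x \<in> V \<Longrightarrow> y \<in> V \<Longrightarrow> E\<^sup>*\<^sup>* x y"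
    and deg: "\<And>x. x \<in> V \<Longrightarrow> card {y. E x y} = 2" and "cycle_length n"
  shows "n = card V"
proof -
  obtain xs where xs: "vertex_cycle xs" "length xs = n"
    using assms(3) by (auto simp: cycle_length_def)
  have V: "set xs \<subseteq> V" using vertex_cycle_two_neighbours[OF xs(1)] E_V by blast
  have closed: "y \<in> set xs" if xy: "x \<in> set xs" "E x y" for x y
  proof -
    obtain u v where uv: "u \<noteq> v" "E x u" "E x v" "u \<in> set xs" "v \<in> set xs"
      using vertex_cycle_two_neighbours[OF xs(1) xy(1)] .
    have "{u, v} = {y. E x y}"
      by (rule card_subset_eq[OF finite_neighbours]) (use uv deg V xy in auto)
    then show ?thesis using uv xy by auto
  qed
  obtain x where x: "x \<in> set xs" using xs(1) by (cases xs) (auto simp: vertex_cycle_def)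
  have "y \<in> set xs" if "E\<^sup>*\<^sup>* x y" for y
    using that by induction (auto intro: x closed)
  then have "V \<subseteq> set xs" using conn x V by blast
  then have "set xs = V" using V by blast
  then show ?thesis using xs distinct_card[of xs] by (simp add: vertex_cycle_def)
qed

end

subsection \<open>Arc walks and vertex lists\<close>

text \<open>The tails of the arcs list the vertices of the walk without the final one, as
  \<open>vertex_cycle\<close> expects.\<close>

lemma pcas_map_fst:
  assumes "pcas u p v" "p \<noteq> []" "set p \<subseteq> A"
  shows "successively (\<lambda>x y. (x, y) \<in> A) (map fst p) \<and> (fst (last p), v) \<in> A \<and> fst (hd p) = u
    \<and> pawalk_verts u p = map fst p @ [v]"
  using assms
proof (induction p arbitrary: u)
  case (Cons e p)
  show ?case
  proof (cases p)
    case Nil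
    with Cons.prems show ?thesis by (cases e) auto
  next
    case (Cons e' p')
    with Cons.IH[of "snd e"] Cons.prems show ?thesis by (cases e) auto
  qed
qed simp

lemma pcas_zip:
  "pcas x (zip (x # ys) (ys @ [z])) z \<and> pawalk_verts x (zip (x # ys) (ys @ [z])) = x # ys @ [z]"
  by (induction ys arbitrary: x) auto

lemma set_zip_successively:
  assumes "successively (\<lambda>x y. (x, y) \<in> A) (x # ys)" "(last (x # ys), z) \<in> A"
  shows "set (zip (x # ys) (ys @ [z])) \<subseteq> A"
  using assms by (induction ys arbitrary: x) auto

lemma pair_graph_finite_simple_graph:
  assumes "pair_graph G"
  shows "finite_simple_graph (pverts G) (\<lambda>x y. (x, y) \<in> parcs G)"
proof -
  interpret pair_graph G by fact
  show ?thesis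
  proof
    show "finite (pverts G)" by (rule pair_finite_verts)
    show "x \<in> pverts G" if "(x, y) \<in> parcs G" for x y using that by (rule in_arcsD1)
    show "(y, x) \<in> parcs G" if "(x, y) \<in> parcs G" for x y
      using that pair_sym_arcs by (auto simp: symmetric_def dest: symD)
    show "(x, x) \<notin> parcs G" for x using pair_no_loops by fastforce
  qed
qed

lemma graph_cycle_length_iff:
  assumes "pair_graph G"
  shows "(\<exists>p. graph_cycle G p \<and> length p = n) \<longleftrightarrow>
    finite_simple_graph.cycle_length (\<lambda>x y. (x, y) \<in> parcs G) n"
proof -
  interpret pair_graph G by fact
  interpret F: finite_simple_graph "pverts G" "\<lambda>x y. (x, y) \<in> parcs G"
    using assms by (rule pair_graph_finite_simple_graph)
  show ?thesis
  proof
    assume "\<exists>p. graph_cycle G p \<and> length p = n"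
    then obtain p u where p: "awalk u p u" "distinct (tl (pawalk_verts u p))" "p \<noteq> []"
        "3 \<le> length p" "length p = n"
      by (auto simp: graph_cycle_def cycle_def)
    have "pcas u p u" "set p \<subseteq> parcs G" using p(1) by (auto simp: awalk_def)
    from pcas_map_fst[OF this(1) p(3) this(2)] have
      q: "successively (\<lambda>x y. (x, y) \<in> parcs G) (map fst p)" "(fst (last p), u) \<in> parcs G"
        "fst (hd p) = u" "pawalk_verts u p = map fst p @ [u]" by auto
    \<comment> \<open>\<open>cycle\<close> drops the first vertex and keeps the last; both are
      \<open>u\<close>, so dropping the last is equivalent.\<close>
    then have "distinct (map fst p)" using p(2,3) by (cases p) auto
    then have "F.vertex_cycle (map fst p)"
      using p q by (simp add: F.vertex_cycle_def last_map hd_map)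
    then show "F.cycle_length n" using p(5) by (auto simp: F.cycle_length_def)
  next
    assume "F.cycle_length n"
    then obtain xs where xs: "F.vertex_cycle xs" "length xs = n" by (auto simp: F.cycle_length_def)
    then obtain x ys where ys: "xs = x # ys" by (cases xs) (auto simp: F.vertex_cycle_def)
    define p where "p = zip (x # ys) (ys @ [x])"
    have "set p \<subseteq> parcs G"
      unfolding p_def using xs(1) by (intro set_zip_successively) (auto simp: F.vertex_cycle_def ys)
    moreover have "(last xs, x) \<in> parcs G" using xs(1) by (simp add: F.vertex_cycle_def ys)
    then have "x \<in> pverts G" by (rule in_arcsD2)
    ultimately have "awalk x p x" using pcas_zip[of x ys x] by (simp add: awalk_def p_def)
    moreover have "distinct (tl (pawalk_verts x p))"
      using pcas_zip[of x ys x] xs(1) by (auto simp: p_def F.vertex_cycle_def ys)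
    moreover have "length p = n" using xs ys by (simp add: p_def)
    moreover have "3 \<le> n" using xs by (simp add: F.vertex_cycle_def)
    ultimately show "\<exists>p. graph_cycle G p \<and> length p = n"
      by (intro exI[of _ p]) (auto simp: graph_cycle_def cycle_def)
  qed
qed

lemma out_degree_eq_card_neighbours:
  "out_degree (with_proj G) v = card {y. (v, y) \<in> parcs G}"
proof -
  have "out_arcs (with_proj G) v = Pair v ` {y. (v, y) \<in> parcs G}"
    by (auto simp: out_arcs_def)
  then show ?thesis by (simp add: out_degree_def card_image inj_on_def)
qed

lemma connected_imp_rtranclp:
  assumes "pair_graph G" "connected (with_proj G)" "x \<in> pverts G" "y \<in> pverts G"
  shows "(\<lambda>x y. (x, y) \<in> parcs G)\<^sup>*\<^sup>* x y"
proof -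
  interpret pair_graph G by fact
  have "strongly_connected (with_proj G)"
    using symmetric_connected_imp_strongly_connected[OF pair_sym_arcs assms(2)] .
  then have "x \<rightarrow>\<^sup>*\<^bsub>with_proj G\<^esub> y" using assms(3,4) by (auto simp: strongly_connected_def)
  then have "(x, y) \<in> rtrancl_on (pverts G) (parcs G)" by (simp add: reachable_def)
  then show ?thesis
    by (induction rule: rtrancl_on_induct) (auto intro: rtranclp.rtrancl_into_rtrancl)
qed

section \<open>Regular graphs with two types of cycles\<close>

theorem theorem27:
  fixes G :: "'a pair_pre_digraph" and i j :: nat
  assumes "i \<in> {0, 1, 2, 3}" and "j \<in> {0, 1, 2, 3}" and "i \<noteq> j"
    and "G \<in> \<epsilon> i j"
  shows "regular G \<longleftrightarrow>
    euler_graph G \<and> bipartite G \<and> (\<exists>d > 2. regular_of_degree G d)"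
proof
  assume "regular G"
  then obtain d where d: "regular_of_degree G d" by (auto simp: regular_def)
  have euler: "euler_graph G" using assms(4) by (simp add: two_type_euler_def)
  then have G: "pair_graph G" "connected (with_proj G)" by (auto simp: euler_graph_def)
  interpret F: finite_simple_graph "pverts G" "\<lambda>x y. (x, y) \<in> parcs G"
    using G(1) by (rule pair_graph_finite_simple_graph)
  note conn = connected_imp_rtranclp[OF G]
  have mod4: "i mod 4 = i" "j mod 4 = j" using assms(1,2) by auto
  have types: "n mod 4 = i \<or> n mod 4 = j" if "F.cycle_length n" for n
    using that assms(4) mod4 unfolding graph_cycle_length_iff[OF G(1), symmetric]
    by (auto simp: two_type_euler_def cycle_of_type_def)
  \<comment> \<open>Cycles of both types have different lengths; this later excludes d = 2.\<close>
  obtain m n where mn: "F.cycle_length m" "m mod 4 = i" "F.cycle_length n" "n mod 4 = j"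
    using assms(4) mod4 unfolding graph_cycle_length_iff[OF G(1), symmetric]
    by (auto simp: two_type_euler_def cycle_of_type_def)
  obtain xs where "F.vertex_cycle xs" using mn(1) by (auto simp: F.cycle_length_def)
  \<comment> \<open>An edge of a cycle, which excludes d = 0.\<close>
  then obtain r y where ry: "(r, y) \<in> parcs G" by (auto simp: F.vertex_cycle_def)
  then have r: "r \<in> pverts G" by (rule F.E_V)
  have deg: "card {y. (x, y) \<in> parcs G} = d" if "x \<in> pverts G" for x
    using d that by (simp add: regular_of_degree_def out_degree_eq_card_neighbours)
  have "card {y. (r, y) \<in> parcs G} \<noteq> 0"
    using ry F.finite_neighbours[of r] by (simp only: card_0_eq) blast
  then have "d \<noteq> 0" by (simp only: deg[OF r] not_False_eq_True)
  moreover have "d \<noteq> 2"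
  proof
    assume "d = 2"
    then have "m = card (pverts G)" "n = card (pverts G)"
      using F.cycle_length_two_regular[OF conn] deg mn(1,3) by blast+
    then show False using mn assms(3) by simp
  qed
  moreover have "even d"
    using euler r d by (auto simp: euler_graph_def regular_of_degree_def)
  ultimately have "4 \<le> d" by (auto elim!: evenE)
  have "{i, j} = {0, 2}"
  proof (rule F.cycle_types_min_degree_4[OF _ _ types assms(1,2)])
    show "pverts G \<noteq> {}" using r by blast
    show "4 \<le> card {y. (x, y) \<in> parcs G}" if "x \<in> pverts G" for x
      using deg[OF that] \<open>4 \<le> d\<close> by simp
  qed
  then have "i \<in> {0, 2}" "j \<in> {0, 2}" by (metis insertI1, metis insertI1 insert_commute)
  have "even k" if "F.cycle_length k" for k
  proof -
    have "k mod 4 = 0 \<or> k mod 4 = 2"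
      using types[OF that] \<open>i \<in> {0, 2}\<close> \<open>j \<in> {0, 2}\<close> by force
    then show ?thesis by presburger
  qed
  from F.two_colouring[OF conn[OF r] this] obtain U W where "pverts G = U \<union> W" "U \<inter> W = {}"
    "\<And>x y. (x, y) \<in> parcs G \<Longrightarrow> x \<in> U \<and> y \<in> W \<or> x \<in> W \<and> y \<in> U"
    by blast
  then have "bipartite G" unfolding bipartite_def by (intro exI[of _ U] exI[of _ W]) auto
  moreover have "2 < d" using \<open>4 \<le> d\<close> by simp
  ultimately show "euler_graph G \<and> bipartite G \<and> (\<exists>d > 2. regular_of_degree G d)"
    using euler d by blast
next
  assume "euler_graph G \<and> bipartite G \<and> (\<exists>d > 2. regular_of_degree G d)"
  then show "regular G" by (auto simp: regular_def)
qed

end
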